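(* Let $k$ be a positive integer and $n\ge 2k$. Let $\mathcal{A}_1=2^{[k]}\setminus\{\emptyset\}$, $\mathcal{A}_2=2^{\{k+1,\dots,2k-1\}}\setminus\{\emptyset\}$, $\mathcal{A}_{1,2}=\{[k]\cup A: A\in\mathcal{A}_2\}$, and \[\mathcal{F}=\mathcal{F}_k=\{\emptyset,[n]\}\cup(\mathcal{A}_1\cup\mathcal{A}_2\cup\mathcal{A}_{1,2})\cup(\mathcal{A}_1\cup\mathcal{A}_2\cup\mathcal{A}_{1,2})^c,\] where $\mathcal{H}^c=\{[n]\setminus H:H\in\mathcal{H}\}$. Then $\mathcal{F}$ contains no induced copy of $2C_k+C_1$, and there is a constant $c$ depending only on $k$ such that for all but at most $c$ sets $G\in 2^{[n]}\setminus\mathcal{F}$, the family $\mathcal{F}\cup\{G\}$ contains an induced copy of $2C_k+C_1$.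
   Context: $[n]=\{1,\dots,n\}$. For a poset $P=(P,\leqslant)$, a family $\mathcal{G}$ of sets is an induced copy of $P$ if there is a bijection $b:P\to\mathcal{G}$ with $p\leqslant q$ if and only if $b(p)\subseteq b(q)$. $C_k$ denotes the $k$-element chain; $2C_k+C_1$ is the poset consisting of two $k$-element chains and one single element, pairwise incomparable.
   Formalization: The second claim (existence of c) is stated only for k ≥ 2: for k = 1, F = {∅,[n],{1},[n]\{1}} and every G contains {1} or lies in [n]\{1}, so no G completes a copy and all 2^n − 4 sets are exceptional. The first claim is for all k ≥ 1. *)

theory Defs
  imports Main
begin

text \<open>A poset is given by its reflexive order relation \<^term>\<open>r\<close>; its underlying set is
  \<^term>\<open>Field r\<close>.\<close>

definition induced_copy :: "'a rel \<Rightarrow> 'b set set \<Rightarrow> bool" where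
  "induced_copy r \<G> \<longleftrightarrow>
     (\<exists>b. bij_betw b (Field r) \<G> \<and>
          (\<forall>p\<in>Field r. \<forall>q\<in>Field r. (p, q) \<in> r \<longleftrightarrow> b p \<subseteq> b q))"

definition contains_induced_copy :: "'b set set \<Rightarrow> 'a rel \<Rightarrow> bool" where
  "contains_induced_copy \<F> r \<longleftrightarrow> (\<exists>\<G>\<subseteq>\<F>. induced_copy r \<G>)"

definition chain_poset :: "nat \<Rightarrow> nat rel" where
  "chain_poset k = {(i, j). 1 \<le> i \<and> i \<le> j \<and> j \<le> k}"

text \<open>Disjoint union of posets, elements of different summands being incomparable.\<close>

definition poset_sum :: "'a rel \<Rightarrow> 'b rel \<Rightarrow> ('a + 'b) rel" where
  "poset_sum r s = map_prod Inl Inl ` r \<union> map_prod Inr Inr ` s"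

definition two_chains_plus_point :: "nat \<Rightarrow> ((nat + nat) + nat) rel" where
  "two_chains_plus_point k =
     poset_sum (poset_sum (chain_poset k) (chain_poset k)) (chain_poset 1)"

definition family_A1 :: "nat \<Rightarrow> nat set set" where
  "family_A1 k = Pow {1..k} - {{}}"

text \<open>For \<^term>\<open>k = (1::nat)\<close> the next family is empty. Then no \<open>family_F 1 n \<union> {G}\<close>
  has three pairwise incomparable members: each subset of \<^term>\<open>{1..n}\<close> either contains
  \<^term>\<open>{1}\<close> or is contained in \<^term>\<open>{1..n} - {1}\<close>.\<close>

definition family_A2 :: "nat \<Rightarrow> nat set set" where
  "family_A2 k = Pow {k + 1..2 * k - 1} - {{}}"

definition family_A12 :: "nat \<Rightarrow> nat set set" where
  "family_A12 k = {{1..k} \<union> A | A. A \<in> family_A2 k}"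

definition compl_family :: "nat \<Rightarrow> nat set set \<Rightarrow> nat set set" where
  "compl_family n \<H> = {{1..n} - H | H. H \<in> \<H>}"

definition family_F :: "nat \<Rightarrow> nat \<Rightarrow> nat set set" where
  "family_F k n =
     {{}, {1..n}} \<union> (family_A1 k \<union> family_A2 k \<union> family_A12 k)
       \<union> compl_family n (family_A1 k \<union> family_A2 k \<union> family_A12 k)"

lemma Field_chain_poset: "Field (chain_poset k) = {1..k}"
  by (force simp: chain_poset_def Field_def)

lemma Linear_order_chain_poset: "Linear_order (chain_poset k)"
  unfolding Field_chain_poset
  by (auto simp: chain_poset_def linear_order_on_def partial_order_on_def preorder_on_def
      refl_on_def trans_def antisym_def total_on_def)

lemma Field_poset_sum: "Field (poset_sum r s) = Field r <+> Field s"
  by (force simp: poset_sum_def Field_def)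

lemma poset_sum_iff [simp]:
  "(Inl x, Inl x') \<in> poset_sum r s \<longleftrightarrow> (x, x') \<in> r"
  "(Inr y, Inr y') \<in> poset_sum r s \<longleftrightarrow> (y, y') \<in> s"
  "(Inl x, Inr y) \<notin> poset_sum r s"
  "(Inr y, Inl x) \<notin> poset_sum r s"
  by (auto simp: poset_sum_def)

end

theory Submission
  imports Defs
begin

text \<open>
  Split the ground set \<open>N\<close> into \<open>X = {1..k}\<close>, \<open>Y = {k+1..2k-1}\<close> and \<open>Z = {2k..n}\<close>. The family consists
  of the sets that are contained in \<open>X\<close> or contain \<open>Y \<union> Z\<close> (\<open>X\<close>-type), together with the sets that
  split neither \<open>X\<close> nor \<open>Z\<close> (\<open>Y\<close>-type). It is closed under complements, which reverse inclusion.

  A set of either type is determined by its trace on \<open>k + 1\<close> points (\<open>X\<close> and one point of \<open>Z\<close>, resp.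
  \<open>Y\<close> and one point each of \<open>X\<close> and \<open>Z\<close>), so the traces of a \<open>k\<close>-chain of one type that avoids the
  empty set and \<open>N\<close> have exactly the sizes \<open>1, \<dots>, k\<close>. In a copy of the poset both chains must be of one
  type, and inspecting the traces of size \<open>1\<close> and \<open>k\<close> shows that each chain contains a singleton and
  the complement of a singleton. If \<open>{a}\<close> lies in the first chain and \<open>N - {b}\<close> in the second, then
  \<open>a = b\<close>; but the isolated element has to avoid \<open>a\<close> and to contain \<open>b\<close>.

  Conversely, every \<open>G\<close> that splits \<open>Z\<close> completes a copy, so at most \<open>2 \<cdot> 2^(2k)\<close> sets fail. If \<open>G\<close>
  splits \<open>X\<close>, it is the isolated element next to maximal chains from \<open>X\<close> to \<open>X \<union> Y\<close> and from \<open>Z\<close> to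
  \<open>Y \<union> Z\<close>. If \<open>G\<close> is disjoint from \<open>X\<close>, one chain consists of subsets of \<open>X\<close>, and \<open>G\<close> belongs to the
  other chain, whose members lie in \<open>Y \<union> Z\<close>. The case \<open>X \<subseteq> G\<close> follows by taking complements.
\<close>

section \<open>Copies of the poset as two chains and an extra set\<close>

definition incomparable :: "'a set \<Rightarrow> 'a set \<Rightarrow> bool" where
  "incomparable S T \<longleftrightarrow> \<not> S \<subseteq> T \<and> \<not> T \<subseteq> S"

lemma incomparable_sym: "incomparable S T \<Longrightarrow> incomparable T S"
  by (simp add: incomparable_def)

text \<open>The chains are bare sets of sets, so no enumeration has to be carried along.
  Incomparability also keeps \<open>C\<close>, \<open>D\<close> and \<open>e\<close> apart, since no
  set is incomparable to itself.\<close>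

definition two_chains_and_point ::
  "nat \<Rightarrow> 'a set set \<Rightarrow> 'a set set \<Rightarrow> 'a set set \<Rightarrow> 'a set \<Rightarrow> bool" where
  "two_chains_and_point k \<F> C D e \<longleftrightarrow>
     C \<subseteq> \<F> \<and> D \<subseteq> \<F> \<and> e \<in> \<F> \<and> chain_subset C \<and> chain_subset D \<and> card C = k \<and> card D = k \<and>
     (\<forall>S\<in>C. \<forall>T\<in>D. incomparable S T) \<and> (\<forall>S\<in>C \<union> D. incomparable S e)"

lemma two_chains_and_pointI:
  assumes "C \<subseteq> \<F>" "D \<subseteq> \<F>" "e \<in> \<F>" "chain_subset C" "chain_subset D" "card C = k" "card D = k"
    "\<And>S T. S \<in> C \<Longrightarrow> T \<in> D \<Longrightarrow> incomparable S T"
    "\<And>S. S \<in> C \<Longrightarrow> incomparable S e" "\<And>S. S \<in> D \<Longrightarrow> incomparable S e"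
  shows "two_chains_and_point k \<F> C D e"
  using assms unfolding two_chains_and_point_def by blast

lemma two_chains_and_pointD:
  assumes "two_chains_and_point k \<F> C D e"
  shows "C \<subseteq> \<F>" "D \<subseteq> \<F>" "e \<in> \<F>" "chain_subset C" "chain_subset D" "card C = k" "card D = k"
    "\<And>S T. S \<in> C \<Longrightarrow> T \<in> D \<Longrightarrow> incomparable S T"
    "\<And>S. S \<in> C \<Longrightarrow> incomparable S e" "\<And>S. S \<in> D \<Longrightarrow> incomparable S e"
  using assms unfolding two_chains_and_point_def by blast+

lemma two_chains_and_point_swap:
  "two_chains_and_point k \<F> C D e \<Longrightarrow> two_chains_and_point k \<F> D C e"
  unfolding two_chains_and_point_def by (auto intro: incomparable_sym)

lemma chain_subset_complements:
  "chain_subset C \<Longrightarrow> chain_subset ((-) N ` C)"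
  unfolding chain_subset_def by blast

lemma incomparable_complements:
  "S \<subseteq> N \<Longrightarrow> T \<subseteq> N \<Longrightarrow> incomparable S T \<Longrightarrow> incomparable (N - S) (N - T)"
  unfolding incomparable_def by blast

lemma inj_on_complements: "inj_on ((-) N) (Pow N)"
  by (rule inj_onI) blast

text \<open>Complementation is an order-reversing bijection of \<open>Pow N\<close>. This symmetry
  halves the later case distinctions.\<close>

lemma two_chains_and_point_complements:
  assumes "two_chains_and_point k \<F> C D e" "\<F> \<subseteq> Pow N"
  shows "two_chains_and_point k ((-) N ` \<F>) ((-) N ` C) ((-) N ` D) (N - e)"
proof -
  note cfg = two_chains_and_pointD[OF assms(1)]
  have sub: "C \<subseteq> Pow N" "D \<subseteq> Pow N" "e \<subseteq> N"
    using cfg(1-3) assms(2) by auto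
  have card: "card ((-) N ` C) = k" "card ((-) N ` D) = k"
    using cfg(6,7) sub inj_on_complements inj_on_subset card_image by metis+
  show ?thesis
  proof (rule two_chains_and_pointI)
    fix S T assume "S \<in> (-) N ` C" "T \<in> (-) N ` D"
    then show "incomparable S T"
      using cfg(8) sub by (auto intro!: incomparable_complements)
  next
    fix S assume "S \<in> (-) N ` C"
    then show "incomparable S (N - e)"
      using cfg(9) sub by (auto intro!: incomparable_complements)
  next
    fix S assume "S \<in> (-) N ` D"
    then show "incomparable S (N - e)"
      using cfg(10) sub by (auto intro!: incomparable_complements)
  qed (use cfg card in \<open>auto intro: chain_subset_complements\<close>)
qed

text \<open>The enumeration inverts the rank \<open>h\<close>, which counts the members of
  \<open>C\<close> below a given one, itself included.\<close>

lemma ex_chain_enumeration: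
  assumes "finite C" "chain_subset C" "card C = k"
  shows "\<exists>f. bij_betw f {1..k} C \<and> (\<forall>i\<in>{1..k}. \<forall>j\<in>{1..k}. f i \<subseteq> f j \<longleftrightarrow> i \<le> j)"
proof -
  define h where "h S = card {T \<in> C. T \<subseteq> S}" for S
  have le: "h S \<le> h T" if "S \<subseteq> T" for S T
    unfolding h_def using that assms(1) by (intro card_mono) auto
  have less: "h S < h T" if "S \<subset> T" "T \<in> C" for S T
    unfolding h_def using that assms(1) by (intro psubset_card_mono) auto
  have iff: "h S \<le> h T \<longleftrightarrow> S \<subseteq> T" if "S \<in> C" "T \<in> C" for S T
  proof
    assume "h S \<le> h T"
    then have "\<not> T \<subset> S" using less[of T S] that by linarith
    then show "S \<subseteq> T" using assms(2) that unfolding chain_subset_def by blast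
  qed (rule le)
  have inj: "inj_on h C"
    by (rule inj_onI) (metis iff order_refl subset_antisym)
  have "h ` C \<subseteq> {1..k}"
  proof
    fix i assume "i \<in> h ` C"
    then obtain S where S: "S \<in> C" "i = h S" by blast
    have "card {S} \<le> h S" "h S \<le> card C"
      unfolding h_def using S assms(1) by (intro card_mono; auto)+
    then show "i \<in> {1..k}" using S assms(3) by simp
  qed
  then have "h ` C = {1..k}"
    using card_image[OF inj] assms(3) by (intro card_subset_eq) auto
  with inj have bij: "bij_betw h C {1..k}" by (simp add: bij_betw_def)
  define f where "f = the_inv_into C h"
  have f: "bij_betw f {1..k} C"
    unfolding f_def by (rule bij_betw_the_inv_into[OF bij])
  have "h (f i) = i" if "i \<in> {1..k}" for i
    unfolding f_def using that bij by (simp add: f_the_inv_into_f_bij_betw)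
  then have "f i \<subseteq> f j \<longleftrightarrow> i \<le> j" if "i \<in> {1..k}" "j \<in> {1..k}" for i j
    using iff[of "f i" "f j"] that f by (simp add: bij_betw_apply)
  with f show ?thesis by blast
qed

lemma Field_two_chains_plus_point:
  "Field (two_chains_plus_point k) = ({1..k} <+> {1..k}) <+> {1}"
  by (simp add: two_chains_plus_point_def Field_poset_sum Field_chain_poset)

lemma contains_two_chains_plus_point_iff:
  assumes "k \<ge> 1"
  shows "contains_induced_copy \<F> (two_chains_plus_point k) \<longleftrightarrow>
         (\<exists>C D e. two_chains_and_point k \<F> C D e)"
proof
  assume "contains_induced_copy \<F> (two_chains_plus_point k)"
  then obtain \<G> b where G: "\<G> \<subseteq> \<F>"
    and b: "bij_betw b (({1..k} <+> {1..k}) <+> {1}) \<G>"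
    and ord: "\<And>p q. p \<in> ({1..k} <+> {1..k}) <+> {1} \<Longrightarrow> q \<in> ({1..k} <+> {1..k}) <+> {1} \<Longrightarrow>
      (p, q) \<in> two_chains_plus_point k \<longleftrightarrow> b p \<subseteq> b q"
    unfolding contains_induced_copy_def induced_copy_def Field_two_chains_plus_point by blast
  define f g e where "f i = b (Inl (Inl i))" and "g i = b (Inl (Inr i))" and "e = b (Inr 1)" for i
  have inj: "inj_on f {1..k}" "inj_on g {1..k}"
    using b by (auto simp: bij_betw_def inj_on_def f_def g_def)
  have sub: "f ` {1..k} \<subseteq> \<F>" "g ` {1..k} \<subseteq> \<F>" "e \<in> \<F>"
    using b G by (auto simp: bij_betw_def f_def g_def e_def)
  have "two_chains_and_point k \<F> (f ` {1..k}) (g ` {1..k}) e"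
  proof (rule two_chains_and_pointI)
    have "f i \<subseteq> f j \<longleftrightarrow> i \<le> j" if "i \<in> {1..k}" "j \<in> {1..k}" for i j
      using ord[OF InlI[OF InlI[OF that(1)]] InlI[OF InlI[OF that(2)]]] that
      by (simp add: f_def two_chains_plus_point_def chain_poset_def)
    then show "chain_subset (f ` {1..k})"
      unfolding chain_subset_def by (metis imageE nle_le)
    have "g i \<subseteq> g j \<longleftrightarrow> i \<le> j" if "i \<in> {1..k}" "j \<in> {1..k}" for i j
      using ord[OF InlI[OF InrI[OF that(1)]] InlI[OF InrI[OF that(2)]]] that
      by (simp add: g_def two_chains_plus_point_def chain_poset_def)
    then show "chain_subset (g ` {1..k})"
      unfolding chain_subset_def by (metis imageE nle_le)
  next
    fix S T assume "S \<in> f ` {1..k}" "T \<in> g ` {1..k}"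
    then obtain i j where ij: "i \<in> {1..k}" "j \<in> {1..k}" "S = f i" "T = g j" by blast
    have "Inl (Inl i) \<in> ({1..k} <+> {1..k}) <+> {1}" "Inl (Inr j) \<in> ({1..k} <+> {1..k}) <+> {1}"
      using ij by auto
    from ord[OF this] ord[OF this(2,1)] ij show "incomparable S T"
      by (simp add: f_def g_def two_chains_plus_point_def incomparable_def)
  next
    fix S assume "S \<in> f ` {1..k}"
    then obtain i where i: "i \<in> {1..k}" "S = f i" by blast
    have "Inl (Inl i) \<in> ({1..k} <+> {1..k}) <+> {1}" "Inr 1 \<in> ({1..k} <+> {1..k}) <+> {1}"
      using i by auto
    from ord[OF this] ord[OF this(2,1)] i show "incomparable S e"
      by (simp add: f_def e_def two_chains_plus_point_def incomparable_def)
  next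
    fix S assume "S \<in> g ` {1..k}"
    then obtain i where i: "i \<in> {1..k}" "S = g i" by blast
    have "Inl (Inr i) \<in> ({1..k} <+> {1..k}) <+> {1}" "Inr 1 \<in> ({1..k} <+> {1..k}) <+> {1}"
      using i by auto
    from ord[OF this] ord[OF this(2,1)] i show "incomparable S e"
      by (simp add: g_def e_def two_chains_plus_point_def incomparable_def)
  qed (use sub inj in \<open>auto simp: card_image\<close>)
  then show "\<exists>C D e. two_chains_and_point k \<F> C D e" by blast
next
  assume "\<exists>C D e. two_chains_and_point k \<F> C D e"
  then obtain C D e where "two_chains_and_point k \<F> C D e" by blast
  note cfg = two_chains_and_pointD[OF this]
  \<comment> \<open>Infinite sets have \<open>card\<close> 0, so \<open>k \<ge> 1\<close> makes both
    chains finite.\<close>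
  have "finite C" "finite D"
    using cfg(6,7) assms by (auto intro: card_ge_0_finite)
  with cfg obtain f g where
    f: "bij_betw f {1..k} C" "\<And>i j. i\<in>{1..k} \<Longrightarrow> j\<in>{1..k} \<Longrightarrow> f i \<subseteq> f j \<longleftrightarrow> i \<le> j" and
    g: "bij_betw g {1..k} D" "\<And>i j. i\<in>{1..k} \<Longrightarrow> j\<in>{1..k} \<Longrightarrow> g i \<subseteq> g j \<longleftrightarrow> i \<le> j"
    by (metis ex_chain_enumeration)
  have fC: "f i \<in> C" and gD: "g i \<in> D" if "i \<in> {1..k}" for i
    using that f(1) g(1) by (auto simp: bij_betw_apply)
  define b where "b = case_sum (case_sum f g) (\<lambda>_::nat. e)"
  have ord: "(p, q) \<in> two_chains_plus_point k \<longleftrightarrow> b p \<subseteq> b q"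
    if "p \<in> ({1..k} <+> {1..k}) <+> {1}" "q \<in> ({1..k} <+> {1..k}) <+> {1}" for p q
    using that f(2) g(2) cfg(8)[OF fC gD] cfg(9)[OF fC] cfg(10)[OF gD]
    by (elim PlusE) (simp_all add: b_def two_chains_plus_point_def chain_poset_def incomparable_def)
  \<comment> \<open>Elements with the same image are related in both directions, so injectivity of
    \<open>b\<close> reduces to antisymmetry of the poset.\<close>
  have antisym: "p = q" if "(p, q) \<in> two_chains_plus_point k" "(q, p) \<in> two_chains_plus_point k" for p q
    using that by (auto simp: two_chains_plus_point_def poset_sum_def chain_poset_def)
  have "inj_on b (({1..k} <+> {1..k}) <+> {1})"
    by (rule inj_onI) (metis antisym ord order_refl)
  then have "induced_copy (two_chains_plus_point k) (b ` (({1..k} <+> {1..k}) <+> {1}))"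
    unfolding induced_copy_def Field_two_chains_plus_point
    using ord by (intro exI[of _ b]) (auto simp: bij_betw_def)
  moreover have "b ` (({1..k} <+> {1..k}) <+> {1}) \<subseteq> \<F>"
    using fC gD cfg(1-3) by (auto simp: b_def)
  ultimately show "contains_induced_copy \<F> (two_chains_plus_point k)"
    unfolding contains_induced_copy_def by blast
qed

section \<open>Sizes of traces, and saturated chains\<close>

text \<open>Traces of a chain are nested, so distinct traces have distinct sizes. Being nonempty and
  proper in a set of \<open>k + 1\<close> points, the \<open>k\<close> traces take each size from 1
  to \<open>k\<close> once.\<close>

lemma chain_trace_extremes:
  assumes "finite R" "card R = Suc k" "k \<ge> 1" "chain_subset C" "card C = k"
    and inj: "inj_on (\<lambda>S. S \<inter> R) C"
    and proper: "\<And>S. S \<in> C \<Longrightarrow> S \<inter> R \<noteq> {} \<and> S \<inter> R \<noteq> R"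
  shows "\<exists>S\<in>C. \<exists>a. S \<inter> R = {a}" and "\<exists>S\<in>C. \<exists>a\<in>R. S \<inter> R = R - {a}"
proof -
  define h where "h S = card (S \<inter> R)" for S
  have "inj_on h C"
  proof (rule inj_onI)
    fix S T assume ST: "S \<in> C" "T \<in> C" "h S = h T"
    then have "S \<inter> R \<subseteq> T \<inter> R \<or> T \<inter> R \<subseteq> S \<inter> R"
      using assms(4) unfolding chain_subset_def by blast
    then have "S \<inter> R = T \<inter> R"
      using ST(3) assms(1) unfolding h_def by (metis card_subset_eq finite_Int)
    then show "S = T" using inj ST by (auto dest: inj_onD)
  qed
  moreover have "h ` C \<subseteq> {1..k}"
  proof
    fix i assume "i \<in> h ` C"
    then obtain S where S: "S \<in> C" "i = card (S \<inter> R)" by (auto simp: h_def)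
    have "S \<inter> R \<subset> R" "S \<inter> R \<noteq> {}" using proper[OF S(1)] by auto
    then have "card (S \<inter> R) < card R" "card (S \<inter> R) > 0"
      using assms(1) by (auto intro: psubset_card_mono simp: card_gt_0_iff)
    then show "i \<in> {1..k}" using S assms(2) by simp
  qed
  ultimately have "h ` C = {1..k}"
    using assms(5) card_image[of h C] by (intro card_subset_eq) auto
  then have "1 \<in> h ` C" "k \<in> h ` C" using assms(3) by auto
  then obtain S T where S: "S \<in> C" "card (S \<inter> R) = 1" and T: "T \<in> C" "card (T \<inter> R) = k"
    unfolding h_def by (elim imageE) simp
  show "\<exists>S\<in>C. \<exists>a. S \<inter> R = {a}"
    using S by (auto simp: card_1_singleton_iff)
  have "card (R - T \<inter> R) = 1"
    using T assms(1,2) by (subst card_Diff_subset) auto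
  then obtain a where a: "R - T \<inter> R = {a}" by (auto simp: card_1_singleton_iff)
  then have "a \<in> R" "T \<inter> R = R - {a}" by blast+
  then show "\<exists>S\<in>C. \<exists>a\<in>R. S \<inter> R = R - {a}" using T by blast
qed

text \<open>Induction on the gap between \<open>A\<close> and \<open>B\<close>: a chain above
  \<open>insert a A\<close> gains \<open>A\<close> as a least member, which is new because it lacks
  \<open>a\<close>.\<close>

lemma ex_saturated_chain:
  assumes "finite B" "A \<subseteq> B"
  shows "\<exists>C. chain_subset C \<and> card C = Suc (card (B - A)) \<and> (\<forall>S\<in>C. A \<subseteq> S \<and> S \<subseteq> B)"
  using assms
proof (induction "card (B - A)" arbitrary: A)
  case 0
  then show ?case by (intro exI[of _ "{B}"]) (auto simp: chain_subset_def)
next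
  case (Suc m)
  then obtain a where a: "a \<in> B - A" by (metis card.empty nat.distinct(1) equals0I)
  then have "B - insert a A = (B - A) - {a}" by blast
  then have m: "m = card (B - insert a A)" using Suc a by simp
  from Suc.hyps(1)[OF m Suc.prems(1)] a Suc.prems(2) obtain C where C: "chain_subset C"
    "card C = Suc m" "\<forall>S\<in>C. insert a A \<subseteq> S \<and> S \<subseteq> B" using m by auto
  have "A \<notin> C" using C(3) a by blast
  moreover have "finite C" using C(2) by (intro card_ge_0_finite) simp
  ultimately have "card (insert A C) = Suc (Suc m)" using C(2) by simp
  moreover have "chain_subset (insert A C)" using C(1,3) unfolding chain_subset_def by blast
  ultimately show ?case using Suc C by (intro exI[of _ "insert A C"]) auto
qed

lemma chain_subset_Un:
  assumes "chain_subset C" "chain_subset D" "\<And>S T. S \<in> C \<Longrightarrow> T \<in> D \<Longrightarrow> S \<subseteq> T"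
  shows "chain_subset (C \<union> D)"
  using assms unfolding chain_subset_def by blast

text \<open>Starting at a singleton instead of the empty set costs one member of the saturated
  chain.\<close>

lemma ex_saturated_chain_above_empty:
  assumes "finite B"
  shows "\<exists>C. chain_subset C \<and> finite C \<and> card C = card B \<and> (\<forall>S\<in>C. S \<noteq> {} \<and> S \<subseteq> B)"
proof (cases "B = {}")
  case True
  then show ?thesis by (intro exI[of _ "{}"]) (auto simp: chain_subset_def)
next
  case False
  then obtain a where a: "a \<in> B" by blast
  then obtain C where C: "chain_subset C" "card C = Suc (card (B - {a}))" "\<forall>S\<in>C. {a} \<subseteq> S \<and> S \<subseteq> B"
    using ex_saturated_chain[OF assms, of "{a}"] by auto
  have "card C = card B" using C(2) a assms by (metis card_Suc_Diff1)
  moreover have "finite C" using C(2) by (intro card_ge_0_finite) simp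
  ultimately show ?thesis using C by (intro exI[of _ C]) auto
qed

section \<open>The three blocks and their family\<close>

text \<open>\<open>Suc (card Y) = k\<close> gives \<open>Y\<close> its \<open>k - 1\<close> points
  without truncated subtraction and makes \<open>k\<close> positive.\<close>

locale three_blocks =
  fixes X Y Z :: "'a set" and k :: nat
  assumes finite_blocks: "finite X" "finite Y" "finite Z"
    and disjoint_blocks: "X \<inter> Y = {}" "X \<inter> Z = {}" "Y \<inter> Z = {}"
    and card_blocks: "card X = k" "Suc (card Y) = k" "Z \<noteq> {}"
begin

definition ground :: "'a set" where
  "ground = X \<union> Y \<union> Z"

definition X_type :: "'a set \<Rightarrow> bool" where
  "X_type S \<longleftrightarrow> S \<subseteq> X \<or> Y \<union> Z \<subseteq> S"

definition Y_type :: "'a set \<Rightarrow> bool" where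
  "Y_type S \<longleftrightarrow> (X \<subseteq> S \<or> X \<inter> S = {}) \<and> (Z \<subseteq> S \<or> Z \<inter> S = {})"

definition fam :: "'a set set" where
  "fam = {S. S \<subseteq> ground \<and> (X_type S \<or> Y_type S)}"

lemma fam_subset: "fam \<subseteq> Pow ground"
  by (auto simp: fam_def)

lemma k_pos: "k \<ge> 1"
  using card_blocks by simp

lemma X_nonempty: "X \<noteq> {}"
  using card_blocks by auto

lemma types_complement:
  assumes "S \<subseteq> ground"
  shows "X_type (ground - S) \<longleftrightarrow> X_type S" "Y_type (ground - S) \<longleftrightarrow> Y_type S"
  using assms disjoint_blocks unfolding X_type_def Y_type_def ground_def by blast+

lemma fam_complements: "(-) ground ` fam = fam"
proof
  show "(-) ground ` fam \<subseteq> fam"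
    by (auto simp: fam_def types_complement)
  show "fam \<subseteq> (-) ground ` fam"
  proof
    fix S assume "S \<in> fam"
    then have "S = ground - (ground - S)" "ground - S \<in> fam"
      by (auto simp: fam_def types_complement)
    then show "S \<in> (-) ground ` fam" by blast
  qed
qed

section \<open>Smallest and largest members of chains of one type\<close>

lemma X_type_chain:
  assumes "chain_subset C" "card C = k" "\<And>S. S \<in> C \<Longrightarrow> X_type S \<and> S \<subseteq> ground \<and> S \<noteq> {} \<and> S \<noteq> ground"
  shows "(\<exists>a. {a} \<in> C) \<or> Y \<union> Z \<in> C" and "(\<exists>a\<in>ground. ground - {a} \<in> C) \<or> X \<in> C"
proof -
  obtain z where z: "z \<in> Z" using card_blocks by blast
  define R where "R = insert z X"
  have zX: "z \<notin> X" using z disjoint_blocks by blast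
  have R: "finite R" "card R = Suc k"
    using zX finite_blocks card_blocks by (auto simp: R_def)
  \<comment> \<open>Outside \<open>X\<close>, a set of this type has all of
    \<open>Y \<union> Z\<close> or nothing, and \<open>z\<close> tells which; so
    \<open>build\<close> recovers the set from its trace.\<close>
  define build where "build T = (T \<inter> X) \<union> (if z \<in> T then Y \<union> Z else {})" for T
  have build: "S = build (S \<inter> R)" if "S \<in> C" for S
  proof -
    have *: "S \<subseteq> X \<or> Y \<union> Z \<subseteq> S" "S \<subseteq> X \<union> Y \<union> Z"
      using assms(3)[OF that] by (auto simp: X_type_def ground_def)
    have "S \<inter> R \<inter> X = S \<inter> X" "z \<in> S \<inter> R \<longleftrightarrow> z \<in> S"
      by (auto simp: R_def)
    then show ?thesis
      unfolding build_def using * z zX by (cases "S \<subseteq> X") auto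
  qed
  have inj: "inj_on (\<lambda>S. S \<inter> R) C"
    by (rule inj_onI) (metis build)
  have build_empty: "build {} = {}" and build_R: "build R = ground"
    by (auto simp: build_def R_def ground_def)
  \<comment> \<open>Only \<open>{}\<close> and \<open>ground\<close>, both excluded, rebuild from
    the traces \<open>{}\<close> and \<open>R\<close>.\<close>
  have proper: "S \<inter> R \<noteq> {} \<and> S \<inter> R \<noteq> R" if S: "S \<in> C" for S
    using build[OF S] assms(3)[OF S] build_empty build_R by metis
  obtain S a where S: "S \<in> C" "S \<inter> R = {a}"
    using chain_trace_extremes(1)[OF R k_pos assms(1,2) inj proper] by blast
  have "a \<in> R" using S by blast
  then consider "a = z" | "a \<in> X" by (auto simp: R_def)
  then have "build {a} = Y \<union> Z \<or> build {a} = {a}"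
    using zX by cases (auto simp: build_def)
  then show "(\<exists>a. {a} \<in> C) \<or> Y \<union> Z \<in> C" using S build[OF S(1)] by metis
  obtain T b where T: "T \<in> C" "b \<in> R" "T \<inter> R = R - {b}"
    using chain_trace_extremes(2)[OF R k_pos assms(1,2) inj proper] by blast
  consider "b = z" | "b \<in> X" using T by (auto simp: R_def)
  then have "build (R - {b}) = X \<or> b \<in> ground \<and> build (R - {b}) = ground - {b}"
  proof cases
    case 1
    then have "build (R - {b}) = X" using zX by (auto simp: build_def R_def)
    then show ?thesis by blast
  next
    case 2
    then have "b \<notin> Y" "b \<notin> Z" "z \<noteq> b" using disjoint_blocks zX by auto
    then have "build (R - {b}) = ground - {b}" by (auto simp: build_def R_def ground_def)
    then show ?thesis using 2 by (simp add: ground_def)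
  qed
  then show "(\<exists>a\<in>ground. ground - {a} \<in> C) \<or> X \<in> C"
    using T build[OF T(1)] by metis
qed

text \<open>Here \<open>Y\<close> is free, while \<open>X\<close> and \<open>Z\<close> are taken
  whole or not at all. One representative of each joins \<open>Y\<close>, which again makes (k - 1)
  + 2 = k + 1 points.\<close>

lemma Y_type_chain:
  assumes "chain_subset C" "card C = k" "\<And>S. S \<in> C \<Longrightarrow> Y_type S \<and> S \<subseteq> ground \<and> S \<noteq> {} \<and> S \<noteq> ground"
  shows "(\<exists>a. {a} \<in> C) \<or> X \<in> C \<or> Z \<in> C"
    and "(\<exists>a\<in>ground. ground - {a} \<in> C) \<or> Y \<union> Z \<in> C \<or> X \<union> Y \<in> C"
proof -
  obtain z where z: "z \<in> Z" using card_blocks by blast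
  obtain x where x: "x \<in> X" using X_nonempty by blast
  define R where "R = insert x (insert z Y)"
  have notin: "z \<notin> X" "z \<notin> Y" "x \<notin> Y" "x \<notin> Z" "x \<noteq> z" using x z disjoint_blocks by blast+
  have R: "finite R" "card R = Suc k"
    using notin finite_blocks card_blocks by (auto simp: R_def)
  define build where "build T = (T \<inter> Y) \<union> (if x \<in> T then X else {}) \<union> (if z \<in> T then Z else {})" for T
  have build: "S = build (S \<inter> R)" if "S \<in> C" for S
  proof -
    have "X \<subseteq> S \<or> X \<inter> S = {}" "Z \<subseteq> S \<or> Z \<inter> S = {}" "S \<subseteq> X \<union> Y \<union> Z"
      using assms(3)[OF that] by (auto simp: Y_type_def ground_def)
    moreover have "S \<inter> R \<inter> Y = S \<inter> Y" "x \<in> S \<inter> R \<longleftrightarrow> x \<in> S" "z \<in> S \<inter> R \<longleftrightarrow> z \<in> S"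
      by (auto simp: R_def)
    ultimately show ?thesis
      unfolding build_def using x z by (cases "x \<in> S"; cases "z \<in> S") auto
  qed
  have inj: "inj_on (\<lambda>S. S \<inter> R) C"
    by (rule inj_onI) (metis build)
  have build_empty: "build {} = {}" and build_R: "build R = ground"
    by (auto simp: build_def R_def ground_def)
  have proper: "S \<inter> R \<noteq> {} \<and> S \<inter> R \<noteq> R" if S: "S \<in> C" for S
    using build[OF S] assms(3)[OF S] build_empty build_R by metis
  obtain S a where S: "S \<in> C" "S \<inter> R = {a}"
    using chain_trace_extremes(1)[OF R k_pos assms(1,2) inj proper] by blast
  have "a \<in> R" using S by blast
  then consider "a = x" | "a = z" | "a \<in> Y" by (auto simp: R_def)
  then have "build {a} = X \<or> build {a} = Z \<or> build {a} = {a}"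
    using notin by cases (auto simp: build_def)
  then show "(\<exists>a. {a} \<in> C) \<or> X \<in> C \<or> Z \<in> C" using S build[OF S(1)] by metis
  obtain T b where T: "T \<in> C" "b \<in> R" "T \<inter> R = R - {b}"
    using chain_trace_extremes(2)[OF R k_pos assms(1,2) inj proper] by blast
  consider "b = x" | "b = z" | "b \<in> Y" using T by (auto simp: R_def)
  then have "build (R - {b}) = Y \<union> Z \<or> build (R - {b}) = X \<union> Y \<or>
    b \<in> ground \<and> build (R - {b}) = ground - {b}"
  proof cases
    case 1
    then have "build (R - {b}) = Y \<union> Z" using notin by (auto simp: build_def R_def)
    then show ?thesis by blast
  next
    case 2
    then have "build (R - {b}) = X \<union> Y" using notin by (auto simp: build_def R_def)
    then show ?thesis by blast
  next
    case 3
    then have "b \<notin> X" "b \<notin> Z" "x \<noteq> b" "z \<noteq> b" using disjoint_blocks notin by auto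
    then have "build (R - {b}) = ground - {b}" by (auto simp: build_def R_def ground_def)
    then show ?thesis using 3 by (simp add: ground_def)
  qed
  then show "(\<exists>a\<in>ground. ground - {a} \<in> C) \<or> Y \<union> Z \<in> C \<or> X \<union> Y \<in> C"
    using T build[OF T(1)] by metis
qed

section \<open>The family contains no configuration\<close>

text \<open>The sets \<open>{}\<close> and \<open>ground\<close> are comparable to every subset of
  \<open>ground\<close>, in particular to \<open>e\<close>.\<close>

lemma configuration_members:
  assumes "two_chains_and_point k fam C D e" "S \<in> C"
  shows "S \<in> fam" "S \<subseteq> ground" "X_type S \<or> Y_type S" "S \<noteq> {}" "S \<noteq> ground"
  using two_chains_and_pointD(1,3,9)[OF assms(1)] assms(2)
  by (auto simp: fam_def incomparable_def)

lemma configuration_complements: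
  assumes "two_chains_and_point k fam C D e"
  shows "two_chains_and_point k fam ((-) ground ` C) ((-) ground ` D) (ground - e)"
  using two_chains_and_point_complements[OF assms fam_subset] by (simp add: fam_complements)

text \<open>If \<open>C\<close> passes \<open>X\<close>, then \<open>e\<close> and the members of
  \<open>D\<close> lie neither below nor above \<open>X\<close>, which makes them comparable to
  \<open>Y \<union> Z\<close>. Either all of them contain \<open>Y \<union> Z\<close>, and this set
  itself is in \<open>D\<close> and below \<open>e\<close>; or no member of \<open>D\<close> does,
  which excludes every large member that \<open>Y_type_chain\<close> offers.\<close>

lemma no_chain_across_X:
  assumes cfg: "two_chains_and_point k fam C D e" and "S \<in> C" "T \<in> C" "S \<subseteq> X" "X \<subseteq> T"
  shows False
proof -
  note c = two_chains_and_pointD[OF cfg]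
  note swap = two_chains_and_point_swap[OF cfg]
  note mem = configuration_members[OF swap]
  have D: "\<not> U \<subseteq> X" "\<not> X \<subseteq> U" if "U \<in> D" for U
    using c(8)[OF \<open>S \<in> C\<close> that] c(8)[OF \<open>T \<in> C\<close> that] assms(4,5) by (auto simp: incomparable_def)
  have e: "\<not> e \<subseteq> X" "\<not> X \<subseteq> e"
    using c(9)[OF \<open>S \<in> C\<close>] c(9)[OF \<open>T \<in> C\<close>] assms(4,5) by (auto simp: incomparable_def)
  have split: "Y \<union> Z \<subseteq> U \<or> Y_type U \<and> U \<subseteq> Y \<union> Z" if "\<not> U \<subseteq> X" "\<not> X \<subseteq> U" "U \<in> fam" for U
    using that unfolding fam_def X_type_def Y_type_def ground_def by blast
  show False
  proof (cases "\<exists>U\<in>D. Y \<union> Z \<subseteq> U")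
    case True
    then obtain U where "U \<in> D" "Y \<union> Z \<subseteq> U" by blast
    \<comment> \<open>A set below \<open>Y \<union> Z\<close> and one above it would be comparable:
      \<open>U\<close> forces \<open>e\<close> above, and \<open>e\<close> then forces all of
      \<open>D\<close> above.\<close>
    then have e_high: "Y \<union> Z \<subseteq> e"
      using c(10)[of U] split[OF e c(3)] by (auto simp: incomparable_def)
    have D_high: "Y \<union> Z \<subseteq> V" if "V \<in> D" for V
      using c(10)[OF that] split[OF D[OF that] mem(1)[OF that]] e_high by (auto simp: incomparable_def)
    have "X_type V \<and> V \<subseteq> ground \<and> V \<noteq> {} \<and> V \<noteq> ground" if "V \<in> D" for V
      using D_high[OF that] mem[OF that] by (auto simp: X_type_def)
    from X_type_chain(1)[OF c(5,7) this] consider a where "{a} \<in> D" | "Y \<union> Z \<in> D" by blast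
    then show False
    proof cases
      case 1
      then have "Y \<union> Z \<in> D" using D_high[OF 1] card_blocks(3) by (metis Un_empty subset_singletonD)
      then show False using c(10) e_high by (auto simp: incomparable_def)
    next
      case 2
      then show False using c(10) e_high by (auto simp: incomparable_def)
    qed
  next
    case False
    then have low: "Y_type U \<and> U \<subseteq> Y \<union> Z" if "U \<in> D" for U
      using split[OF D[OF that] mem(1)[OF that]] that by blast
    have "Y_type V \<and> V \<subseteq> ground \<and> V \<noteq> {} \<and> V \<noteq> ground" if "V \<in> D" for V
      using low[OF that] mem[OF that] by auto
    from Y_type_chain(2)[OF c(5,7) this]
    consider a where "a \<in> ground" "ground - {a} \<in> D" | "Y \<union> Z \<in> D" | "X \<union> Y \<in> D" by blast
    then show False
    proof cases
      case 1
      \<comment> \<open>A co-singleton inside \<open>Y \<union> Z\<close> leaves only the point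
        \<open>a\<close> in \<open>X\<close>, so it equals \<open>Y \<union> Z\<close>, which this
        case rules out.\<close>
      then have "X - {a} \<subseteq> Y \<union> Z" using low[OF 1(2)] by (auto simp: ground_def)
      then have "X = {a}" using disjoint_blocks X_nonempty by blast
      then have "ground - {a} = Y \<union> Z" using disjoint_blocks unfolding ground_def by auto
      then show False using 1 False by auto
    next
      case 2
      then show False using False by auto
    next
      case 3
      then show False using D by blast
    qed
  qed
qed

lemma no_chain_across_YZ:
  assumes cfg: "two_chains_and_point k fam C D e" and "S \<in> C" "T \<in> C" "S \<subseteq> Y \<union> Z" "Y \<union> Z \<subseteq> T"
  shows False
proof (rule no_chain_across_X[OF configuration_complements[OF cfg]])
  show "ground - T \<in> (-) ground ` C" "ground - S \<in> (-) ground ` C"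
    using assms by auto
  show "ground - T \<subseteq> X" "X \<subseteq> ground - S"
    using assms(4,5) disjoint_blocks by (auto simp: ground_def)
qed

text \<open>A member that is not of Y-type and one that is not of X-type would be a comparable pair
  straddling \<open>X\<close> or \<open>Y \<union> Z\<close>, because a Y-type set contains all of
  \<open>X\<close> or nothing of it.\<close>

lemma chain_is_pure:
  assumes cfg: "two_chains_and_point k fam C D e"
  shows "(\<forall>S\<in>C. X_type S) \<or> (\<forall>S\<in>C. Y_type S)"
proof (rule ccontr)
  assume "\<not> ?thesis"
  then obtain S T where ST: "S \<in> C" "T \<in> C" "\<not> Y_type S" "\<not> X_type T" by blast
  note S = configuration_members[OF cfg ST(1)] and T = configuration_members[OF cfg ST(2)]
  have cmp: "S \<subseteq> T \<or> T \<subseteq> S"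
    using two_chains_and_pointD(4)[OF cfg] ST unfolding chain_subset_def by blast
  have X: "X_type S" and Y: "Y_type T" using ST S T by auto
  show False
  proof (cases "S \<subseteq> X")
    case True
    then have "S \<subseteq> T" using cmp ST by (auto simp: X_type_def)
    then have "X \<subseteq> T" using True Y S(4) unfolding Y_type_def by blast
    then show False using no_chain_across_X[OF cfg ST(1,2) True] by blast
  next
    case False
    then have YZ: "Y \<union> Z \<subseteq> S" using X by (auto simp: X_type_def)
    then have "T \<subseteq> S" using cmp ST by (auto simp: X_type_def)
    moreover have "\<not> X \<subseteq> S" using YZ S(2,5) by (auto simp: ground_def)
    ultimately have "T \<subseteq> Y \<union> Z" using Y T(2) unfolding Y_type_def ground_def by blast
    then show False using no_chain_across_YZ[OF cfg ST(2,1) _ YZ] by blast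
  qed
qed

text \<open>The alternatives \<open>X\<close> and \<open>Y \<union> Z\<close> drop out for both
  types: either set alone already counts as a chain across itself.\<close>

lemma chain_extremes:
  assumes cfg: "two_chains_and_point k fam C D e"
  shows "(\<exists>a. {a} \<in> C) \<or> Z \<in> C" and "(\<exists>a\<in>ground. ground - {a} \<in> C) \<or> X \<union> Y \<in> C"
proof -
  note c = two_chains_and_pointD[OF cfg] and mem = configuration_members[OF cfg]
  have "X \<notin> C" "Y \<union> Z \<notin> C"
    using no_chain_across_X[OF cfg] no_chain_across_YZ[OF cfg] by blast+
  with chain_is_pure[OF cfg] X_type_chain[OF c(4,6)] Y_type_chain[OF c(4,6)] mem
  show "(\<exists>a. {a} \<in> C) \<or> Z \<in> C" "(\<exists>a\<in>ground. ground - {a} \<in> C) \<or> X \<union> Y \<in> C" by metis+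
qed

text \<open>A member of the family not contained in \<open>X \<union> Y\<close> contains all of
  \<open>Z\<close>. This applies to \<open>e\<close> and to \<open>D\<close>, whose small member
  must then be \<open>Z\<close> itself, which lies below \<open>e\<close>.\<close>

lemma XY_notin_chain:
  assumes cfg: "two_chains_and_point k fam C D e"
  shows "X \<union> Y \<notin> C"
proof
  assume XY: "X \<union> Y \<in> C"
  note c = two_chains_and_pointD[OF cfg]
  note swap = two_chains_and_point_swap[OF cfg]
  have D: "\<not> U \<subseteq> X \<union> Y" if "U \<in> D" for U
    using c(8)[OF XY that] by (auto simp: incomparable_def)
  have above_Z: "Z \<subseteq> U" if "\<not> U \<subseteq> X \<union> Y" "U \<in> fam" for U
    using that by (auto simp: fam_def X_type_def Y_type_def ground_def)
  have "Z \<in> D"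
  proof -
    consider a where "{a} \<in> D" | "Z \<in> D" using chain_extremes(1)[OF swap] by blast
    then show ?thesis
    proof cases
      case 1
      then have "Z \<subseteq> {a}" using above_Z D c(2) by blast
      then have "Z = {a}" using card_blocks(3) by blast
      then show ?thesis using 1 by simp
    qed
  qed
  moreover have "Z \<subseteq> e"
    using above_Z[OF _ c(3)] c(9)[OF XY] by (auto simp: incomparable_def)
  ultimately show False using c(10) by (auto simp: incomparable_def)
qed

lemma Z_notin_chain:
  assumes cfg: "two_chains_and_point k fam C D e"
  shows "Z \<notin> C"
proof
  assume "Z \<in> C"
  then have "ground - Z \<in> (-) ground ` C" by blast
  moreover have "ground - Z = X \<union> Y" using disjoint_blocks by (auto simp: ground_def)
  ultimately show False using XY_notin_chain[OF configuration_complements[OF cfg]] by simp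
qed

lemma fam_no_configuration: "\<not> two_chains_and_point k fam C D e"
proof
  assume cfg: "two_chains_and_point k fam C D e"
  note c = two_chains_and_pointD[OF cfg]
  note swap = two_chains_and_point_swap[OF cfg]
  obtain a where a: "{a} \<in> C"
    using chain_extremes(1)[OF cfg] Z_notin_chain[OF cfg] by blast
  obtain b' where b': "b' \<in> ground" "ground - {b'} \<in> D"
    using chain_extremes(2)[OF swap] XY_notin_chain[OF swap] by blast
  have "a \<in> ground" using configuration_members(2)[OF cfg a] by simp
  \<comment> \<open>The point \<open>a\<close> of \<open>ground\<close> lies outside
    \<open>ground - {b'}\<close>, so it is \<open>b'\<close>.\<close>
  then have "a = b'" using c(8)[OF a b'(2)] by (auto simp: incomparable_def)
  moreover have "a \<notin> e" using c(9)[OF a] by (auto simp: incomparable_def)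
  moreover have "b' \<in> e"
    using c(10)[OF b'(2)] c(3) fam_subset by (auto simp: incomparable_def)
  ultimately show False by simp
qed

section \<open>Sets that split \<open>Z\<close> complete a configuration\<close>

text \<open>Both chains run through \<open>card Y + 1\<close> sets. Members of \<open>C\<close>
  contain \<open>X\<close> and miss \<open>Z\<close>, those of \<open>D\<close> the reverse, while
  \<open>G\<close> has and lacks points of both blocks.\<close>

lemma configuration_meeting_X:
  assumes "G \<inter> Z \<noteq> {}" "\<not> Z \<subseteq> G" "X \<inter> G \<noteq> {}" "\<not> X \<subseteq> G"
  shows "\<exists>C D e. two_chains_and_point k (insert G fam) C D e"
proof -
  have diff: "X \<union> Y - X = Y" "Z \<union> Y - Z = Y" using disjoint_blocks by auto
  obtain C where C: "chain_subset C" "card C = k" "\<forall>S\<in>C. X \<subseteq> S \<and> S \<subseteq> X \<union> Y"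
    using ex_saturated_chain[of "X \<union> Y" X] finite_blocks card_blocks by (auto simp: diff)
  obtain D where D: "chain_subset D" "card D = k" "\<forall>S\<in>D. Z \<subseteq> S \<and> S \<subseteq> Z \<union> Y"
    using ex_saturated_chain[of "Z \<union> Y" Z] finite_blocks card_blocks by (auto simp: diff)
  have Cfam: "C \<subseteq> insert G fam"
  proof
    fix S assume "S \<in> C"
    with C(3) have "X \<subseteq> S" "S \<subseteq> X \<union> Y" by auto
    then have "Y_type S \<and> S \<subseteq> ground"
      using disjoint_blocks unfolding Y_type_def ground_def by blast
    then show "S \<in> insert G fam" by (simp add: fam_def)
  qed
  have Dfam: "D \<subseteq> insert G fam"
  proof
    fix S assume "S \<in> D"
    with D(3) have "Z \<subseteq> S" "S \<subseteq> Z \<union> Y" by auto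
    then have "Y_type S \<and> S \<subseteq> ground"
      using disjoint_blocks unfolding Y_type_def ground_def by blast
    then show "S \<in> insert G fam" by (simp add: fam_def)
  qed
  have "two_chains_and_point k (insert G fam) C D G"
  proof (rule two_chains_and_pointI)
    fix S T assume "S \<in> C" "T \<in> D"
    with C(3) D(3) have "X \<subseteq> S" "S \<subseteq> X \<union> Y" "Z \<subseteq> T" "T \<subseteq> Z \<union> Y" by auto
    then show "incomparable S T"
      using disjoint_blocks X_nonempty card_blocks(3) unfolding incomparable_def by blast
  next
    fix S assume "S \<in> C"
    with C(3) have "X \<subseteq> S" "S \<subseteq> X \<union> Y" by auto
    then show "incomparable S G"
      using assms disjoint_blocks unfolding incomparable_def by blast
  next
    fix S assume "S \<in> D"
    with D(3) have "Z \<subseteq> S" "S \<subseteq> Z \<union> Y" by auto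
    then show "incomparable S G"
      using assms disjoint_blocks unfolding incomparable_def by blast
  qed (use C D Cfam Dfam in auto)
  then show ?thesis by blast
qed

text \<open>Nonempty subsets of \<open>X\<close> are incomparable to nonempty subsets of
  \<open>Y \<union> Z\<close>. It remains to find \<open>D\<close> and \<open>e\<close> inside
  \<open>Y \<union> Z\<close>, where the subsets of \<open>Y\<close> and the sets containing
  \<open>Z\<close> are available.\<close>

lemma configuration_avoiding_X:
  assumes k: "k \<ge> 2" and G: "G \<subseteq> ground" "G \<inter> Z \<noteq> {}" "\<not> Z \<subseteq> G" "X \<inter> G = {}"
  shows "\<exists>C D e. two_chains_and_point k (insert G fam) C D e"
proof -
  have fam_low: "S \<in> fam" if "S \<subseteq> Y" for S
    using that disjoint_blocks unfolding fam_def Y_type_def ground_def by blast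
  have fam_high: "S \<in> fam" if "Z \<subseteq> S" "S \<subseteq> Y \<union> Z" for S
    using that disjoint_blocks unfolding fam_def Y_type_def ground_def by blast
  have GYZ: "G \<subseteq> Y \<union> Z" using G by (auto simp: ground_def)
  obtain C where C: "chain_subset C" "card C = k" "\<forall>S\<in>C. S \<noteq> {} \<and> S \<subseteq> X"
    using ex_saturated_chain_above_empty[OF finite_blocks(1)] card_blocks by auto
  have Cfam: "C \<subseteq> insert G fam"
    using C(3) by (auto simp: fam_def X_type_def ground_def)
  have C_incomparable: "incomparable S T" if "S \<in> C" "T \<subseteq> Y \<union> Z" "T \<noteq> {}" for S T
  proof -
    have "S \<noteq> {}" "S \<subseteq> X" using C(3) that by auto
    then show ?thesis using that disjoint_blocks unfolding incomparable_def by blast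
  qed
  have "\<exists>D e. D \<subseteq> insert G fam \<and> e \<in> fam \<and> chain_subset D \<and> card D = k \<and>
    (\<forall>S\<in>insert e D. S \<subseteq> Y \<union> Z \<and> S \<noteq> {}) \<and> (\<forall>S\<in>D. incomparable S e)"
  proof (cases "Y \<subseteq> G")
    case True
    \<comment> \<open>For \<open>k = 1\<close> the block \<open>Y\<close> would be empty;
      \<open>k \<ge> 2\<close> provides the point \<open>y\<close>.\<close>
    have "Y \<noteq> {}" using k card_blocks by auto
    then obtain y where y: "y \<in> Y" by blast
    then obtain D where D: "chain_subset D" "card D = Suc (card (Y - {y}))" "\<forall>S\<in>D. {y} \<subseteq> S \<and> S \<subseteq> Y"
      using ex_saturated_chain[OF finite_blocks(2), of "{y}"] by auto
    have DY: "y \<in> S" "S \<subseteq> Y" if "S \<in> D" for S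
      using D(3) that by auto
    have GY: "\<not> G \<subseteq> Y" using G(2) disjoint_blocks(3) by blast
    have "Suc (card D) = k"
      using D(2) card_blocks(2) y finite_blocks(2) by (metis card_Suc_Diff1)
    moreover have "G \<notin> D" using DY(2) GY by auto
    moreover have "finite D" using D(2) by (intro card_ge_0_finite) simp
    ultimately have card: "card (insert G D) = k" by simp
    \<comment> \<open>The \<open>k - 1\<close> sets from \<open>{y}\<close> to \<open>Y\<close>, and
      \<open>G\<close> on top, all contain \<open>y\<close> and do not contain \<open>Z\<close>; for
      \<open>e\<close> it is the reverse.\<close>
    define e where "e = Z \<union> (Y - {y})"
    have ZY: "\<not> Z \<subseteq> S" if "S \<subseteq> Y" for S
      using that card_blocks(3) disjoint_blocks(3) by blast
    have chain: "chain_subset (insert G D)"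
      using chain_subset_Un[OF D(1), of "{G}"] DY(2) True by (auto simp: chain_subset_def)
    have Dfam: "insert G D \<subseteq> insert G fam" using D(3) fam_low by auto
    have e: "e \<in> fam" "e \<subseteq> Y \<union> Z" "e \<noteq> {}"
      using fam_high[of e] card_blocks(3) by (auto simp: e_def)
    have inc: "incomparable S e" if "S \<in> insert G D" for S
    proof -
      have "y \<in> S" "\<not> Z \<subseteq> S"
        using that DY y True G(3) ZY by auto
      moreover have "y \<notin> e" using y disjoint_blocks by (auto simp: e_def)
      ultimately show ?thesis by (auto simp: incomparable_def e_def)
    qed
    have "\<forall>S\<in>insert e (insert G D). S \<subseteq> Y \<union> Z \<and> S \<noteq> {}"
      using D(3) e(2,3) GYZ G by auto
    moreover have "\<forall>S\<in>insert G D. incomparable S e" using inc by blast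
    ultimately show ?thesis using card chain Dfam e(1)
      by (intro exI[of _ "insert G D"] exI[of _ e] conjI)
  next
    case False
    then obtain y where y: "y \<in> Y" "y \<notin> G" by blast
    \<comment> \<open>Now \<open>{y}\<close> is the isolated set, and the chain avoids
      \<open>y\<close>: it climbs through subsets of \<open>B\<close>, passes \<open>G\<close>, and
      continues from \<open>Z \<union> B\<close> to \<open>Z \<union> (Y - {y})\<close>.\<close>
    define B where "B = G \<inter> Y"
    have yZ: "y \<notin> Z" using y disjoint_blocks by blast
    have B: "B \<subseteq> Y - {y}" "finite B" "B \<subset> G" "G \<subset> Z \<union> B"
      using y G GYZ disjoint_blocks finite_blocks by (auto simp: B_def)
    obtain L where L: "chain_subset L" "finite L" "card L = card B" "\<forall>S\<in>L. S \<noteq> {} \<and> S \<subseteq> B"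
      using ex_saturated_chain_above_empty[OF B(2)] by auto
    obtain U where U: "chain_subset U" "card U = Suc (card (Z \<union> (Y - {y}) - (Z \<union> B)))"
      "\<forall>S\<in>U. Z \<union> B \<subseteq> S \<and> S \<subseteq> Z \<union> (Y - {y})"
      using ex_saturated_chain[of "Z \<union> (Y - {y})" "Z \<union> B"] B finite_blocks by blast
    have LG: "S \<subset> G" if "S \<in> L" for S using that L(4) B(3) by blast
    have GU: "G \<subset> S" if "S \<in> U" for S using that U(3) B(4) by blast
    have "Z \<union> (Y - {y}) - (Z \<union> B) = Y - {y} - B" using disjoint_blocks by auto
    then have "card U = Suc (card (Y - {y}) - card B)"
      using U(2) B by (simp add: card_Diff_subset)
    moreover have "card B \<le> card (Y - {y})" using B finite_blocks by (intro card_mono) auto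
    moreover have "Suc (Suc (card (Y - {y}))) = k"
      using card_blocks(2) y finite_blocks(2) by (metis card_Suc_Diff1)
    \<comment> \<open>\<open>L\<close> has \<open>card B\<close> members and \<open>U\<close> has
      \<open>k - 1 - card B\<close>; \<open>G\<close> supplies the last one.\<close>
    ultimately have "card L + Suc (card U) = k" using L(3) by linarith
    moreover have "finite U" using U(2) by (intro card_ge_0_finite) simp
    moreover have "G \<notin> U" "L \<inter> insert G U = {}"
      using LG GU by blast+
    ultimately have card: "card (L \<union> insert G U) = k"
      using L(2) by (simp add: card_Un_disjoint)
    have "chain_subset (insert G U)"
      using chain_subset_Un[of "{G}" U] U(1) GU by (auto simp: chain_subset_def)
    moreover have "S \<subseteq> T" if "S \<in> L" "T \<in> insert G U" for S T
      using that LG GU by blast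
    ultimately have chain: "chain_subset (L \<union> insert G U)"
      using L(1) by (intro chain_subset_Un)
    have "S \<in> fam" if "S \<in> L" for S using that L(4) B by (intro fam_low) auto
    moreover have "S \<in> fam" if "S \<in> U" for S using that U(3) by (intro fam_high) auto
    ultimately have Dfam: "L \<union> insert G U \<subseteq> insert G fam" by blast
    have D: "S \<subseteq> Y \<union> Z \<and> S \<noteq> {} \<and> y \<notin> S" if S: "S \<in> L \<union> insert G U" for S
    proof -
      consider "S \<in> L" | "S = G" | "S \<in> U" using S by blast
      then show ?thesis
      proof cases
        case 1
        then show ?thesis using L(4) B by blast
      next
        case 2
        then show ?thesis using GYZ G y by blast
      next
        case 3
        then have "Z \<subseteq> S" "S \<subseteq> Z \<union> (Y - {y})" using U(3) by auto
        then show ?thesis using card_blocks(3) yZ by blast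
      qed
    qed
    then have "\<forall>S\<in>L \<union> insert G U. incomparable S {y}"
      unfolding incomparable_def by blast
    moreover have "\<forall>S\<in>insert {y} (L \<union> insert G U). S \<subseteq> Y \<union> Z \<and> S \<noteq> {}"
      using D y by blast
    moreover have "{y} \<in> fam" using y by (intro fam_low) simp
    ultimately show ?thesis using card chain Dfam
      by (intro exI[of _ "L \<union> insert G U"] exI[of _ "{y}"] conjI)
  qed
  then obtain D e where D: "D \<subseteq> insert G fam" "e \<in> fam" "chain_subset D" "card D = k"
    "\<forall>S\<in>insert e D. S \<subseteq> Y \<union> Z \<and> S \<noteq> {}" "\<forall>S\<in>D. incomparable S e" by blast
  have "two_chains_and_point k (insert G fam) C D e"
    by (rule two_chains_and_pointI) (use C Cfam D C_incomparable in auto)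
  then show ?thesis by blast
qed

lemma insert_fam_configuration:
  assumes k: "k \<ge> 2" and G: "G \<subseteq> ground" "G \<inter> Z \<noteq> {}" "\<not> Z \<subseteq> G"
  shows "\<exists>C D e. two_chains_and_point k (insert G fam) C D e"
proof -
  consider "X \<inter> G \<noteq> {}" "\<not> X \<subseteq> G" | "X \<inter> G = {}" | "X \<subseteq> G" by blast
  then show ?thesis
  proof cases
    case 1
    then show ?thesis using configuration_meeting_X G by blast
  next
    case 2
    then show ?thesis using configuration_avoiding_X[OF k G] by blast
  next
    case 3
    \<comment> \<open>The complement of \<open>G\<close> misses \<open>X\<close> and still splits
      \<open>Z\<close>; complementing its configuration brings back \<open>G\<close>.\<close>
    have "(ground - G) \<inter> Z \<noteq> {}" "\<not> Z \<subseteq> ground - G" "X \<inter> (ground - G) = {}"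
      using G 3 by (auto simp: ground_def)
    then obtain C D e where "two_chains_and_point k (insert (ground - G) fam) C D e"
      using configuration_avoiding_X[OF k] by blast
    then have "two_chains_and_point k ((-) ground ` insert (ground - G) fam)
        ((-) ground ` C) ((-) ground ` D) (ground - e)"
      using fam_subset by (intro two_chains_and_point_complements) auto
    moreover have "(-) ground ` insert (ground - G) fam = insert G fam"
      using G by (simp add: fam_complements double_diff)
    ultimately show ?thesis by auto
  qed
qed

end

section \<open>The concrete intervals and the count of exceptions\<close>

lemma three_blocks_intervals:
  assumes "k \<ge> 1" "n \<ge> 2 * k"
  shows "three_blocks {1..k} {k + 1..2 * k - 1} {2 * k..n} k"
  using assms by unfold_locales auto

text \<open>The empty set and the listed sets \<open>L\<close> are the members of the family that
  miss \<open>Z\<close>; \<open>{1..n}\<close> and the complements of \<open>L\<close> are those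
  that contain \<open>Z\<close>.\<close>

lemma family_F_eq_fam:
  assumes "k \<ge> 1" "n \<ge> 2 * k"
  shows "family_F k n = three_blocks.fam {1..k} {k + 1..2 * k - 1} {2 * k..n}"
proof -
  interpret three_blocks "{1..k}" "{k + 1..2 * k - 1}" "{2 * k..n}" k
    by (rule three_blocks_intervals[OF assms])
  define X Y Z where "X = {1..k}" and "Y = {k + 1..2 * k - 1}" and "Z = {2 * k..n}"
  define N where "N = {1..n}"
  have N: "N = X \<union> Y \<union> Z" using assms by (auto simp: N_def X_def Y_def Z_def)
  have disj: "X \<inter> Y = {}" "X \<inter> Z = {}" "Y \<inter> Z = {}" by (auto simp: X_def Y_def Z_def)
  define L where "L = family_A1 k \<union> family_A2 k \<union> family_A12 k"
  have A: "family_A1 k = Pow X - {{}}" "family_A2 k = Pow Y - {{}}"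
    "family_A12 k = {X \<union> A | A. A \<in> Pow Y - {{}}}"
    unfolding family_A1_def family_A2_def family_A12_def X_def Y_def by (rule refl)+
  have L: "S \<in> L \<longleftrightarrow> S \<noteq> {} \<and> (S \<subseteq> X \<or> S \<subseteq> Y \<or> X \<subseteq> S \<and> S \<subseteq> X \<union> Y)" for S
  proof -
    \<comment> \<open>\<open>X\<close> itself is absent here, since \<open>family_A2\<close> omits
      the empty set; \<open>family_A1\<close> supplies it.\<close>
    have "S \<in> family_A12 k \<longleftrightarrow> X \<subseteq> S \<and> S \<subseteq> X \<union> Y \<and> S \<noteq> X"
    proof
      assume "X \<subseteq> S \<and> S \<subseteq> X \<union> Y \<and> S \<noteq> X"
      then have "S = X \<union> (S - X)" "S - X \<in> Pow Y - {{}}" by auto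
      then show "S \<in> family_A12 k" unfolding A by blast
    next
      assume "S \<in> family_A12 k"
      then obtain B where "S = X \<union> B" "B \<subseteq> Y" "B \<noteq> {}" unfolding A by blast
      then show "X \<subseteq> S \<and> S \<subseteq> X \<union> Y \<and> S \<noteq> X" using disj(1) by blast
    qed
    moreover have "X \<noteq> {}" using assms by (simp add: X_def)
    ultimately show ?thesis
      unfolding L_def Un_iff A(1,2) by auto
  qed
  have comp: "S \<in> compl_family n L \<longleftrightarrow> S \<subseteq> N \<and> N - S \<in> L" for S
  proof
    assume "S \<in> compl_family n L"
    then obtain H where H: "H \<in> L" "S = N - H" by (auto simp: compl_family_def N_def)
    then have "H \<subseteq> N" using L N by auto
    then show "S \<subseteq> N \<and> N - S \<in> L" using H by (auto simp: double_diff)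
  next
    assume S: "S \<subseteq> N \<and> N - S \<in> L"
    then have "S = N - (N - S)" by auto
    with S show "S \<in> compl_family n L" unfolding compl_family_def N_def[symmetric] by blast
  qed
  have F: "S \<in> family_F k n \<longleftrightarrow> S = {} \<or> S = N \<or> S \<in> L \<or> S \<subseteq> N \<and> N - S \<in> L" for S
    unfolding family_F_def L_def[symmetric] N_def[symmetric] using comp by auto
  have fam: "S \<in> fam \<longleftrightarrow> S \<subseteq> N \<and> (S \<subseteq> X \<or> Y \<union> Z \<subseteq> S \<or>
      (X \<subseteq> S \<or> X \<inter> S = {}) \<and> (Z \<subseteq> S \<or> Z \<inter> S = {}))" for S
    unfolding N X_def Y_def Z_def fam_def X_type_def Y_type_def ground_def by simp
  have "S \<in> family_F k n \<longleftrightarrow> S \<in> fam" for S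
  proof
    assume "S \<in> fam"
    then have S: "S \<subseteq> N" and "S \<subseteq> X \<or> Y \<union> Z \<subseteq> S \<or>
        (X \<subseteq> S \<or> X \<inter> S = {}) \<and> (Z \<subseteq> S \<or> Z \<inter> S = {})" unfolding fam by auto
    then consider "S \<subseteq> X" | "Y \<union> Z \<subseteq> S" | "X \<subseteq> S" "Z \<subseteq> S" | "X \<subseteq> S" "Z \<inter> S = {}"
      | "X \<inter> S = {}" "Z \<subseteq> S" | "X \<inter> S = {}" "Z \<inter> S = {}" by blast
    then show "S \<in> family_F k n"
      unfolding F L using S N by cases auto
  next
    assume "S \<in> family_F k n"
    then have S: "S \<subseteq> N" and "S = {} \<or> S = N \<or> S \<subseteq> X \<or> S \<subseteq> Y \<or> X \<subseteq> S \<and> S \<subseteq> X \<union> Y \<or>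
        N - S \<subseteq> X \<or> N - S \<subseteq> Y \<or> X \<subseteq> N - S \<and> N - S \<subseteq> X \<union> Y"
      unfolding F L N by auto
    then consider "S \<subseteq> X" | "S = N" | "S \<subseteq> Y" | "X \<subseteq> S" "S \<subseteq> X \<union> Y"
      | "N - S \<subseteq> X" | "N - S \<subseteq> Y" | "X \<subseteq> N - S" "N - S \<subseteq> X \<union> Y" by blast
    then have "S \<subseteq> X \<or> Y \<union> Z \<subseteq> S \<or> (X \<subseteq> S \<or> X \<inter> S = {}) \<and> (Z \<subseteq> S \<or> Z \<inter> S = {})"
    proof cases
      case 3
      then have "X \<inter> S = {}" "Z \<inter> S = {}" using disj by auto
      then show ?thesis by simp
    next
      case 4
      then have "Z \<inter> S = {}" using disj by auto
      then show ?thesis using 4 by simp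
    next
      case 5
      then have "Y \<union> Z \<subseteq> S" using disj N by auto
      then show ?thesis by simp
    next
      case 6
      then have "X \<subseteq> S" "Z \<subseteq> S" using disj N by auto
      then show ?thesis by simp
    next
      case 7
      then have "X \<inter> S = {}" "Z \<subseteq> S" using disj N by auto
      then show ?thesis by simp
    qed (use N in auto)
    then show "S \<in> fam" using S unfolding fam by simp
  qed
  then show ?thesis by blast
qed

text \<open>Such a set is a subset of \<open>M\<close>, or \<open>Z\<close> joined with one.\<close>

lemma card_Pow_avoiding_or_containing:
  assumes "finite M" "N \<subseteq> M \<union> Z"
  shows "card {G \<in> Pow N. G \<inter> Z = {} \<or> Z \<subseteq> G} \<le> 2 * 2 ^ card M"
proof -
  have "{G \<in> Pow N. G \<inter> Z = {} \<or> Z \<subseteq> G} \<subseteq> Pow M \<union> (\<union>) Z ` Pow M"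
  proof
    fix G assume G: "G \<in> {G \<in> Pow N. G \<inter> Z = {} \<or> Z \<subseteq> G}"
    show "G \<in> Pow M \<union> (\<union>) Z ` Pow M"
    proof (cases "Z \<subseteq> G")
      case True
      then have "G = Z \<union> (G - Z)" "G - Z \<in> Pow M" using G assms by auto
      then show ?thesis by blast
    qed (use G assms in auto)
  qed
  then have "card {G \<in> Pow N. G \<inter> Z = {} \<or> Z \<subseteq> G} \<le> card (Pow M \<union> (\<union>) Z ` Pow M)"
    using assms by (intro card_mono) auto
  also have "\<dots> \<le> card (Pow M) + card ((\<union>) Z ` Pow M)" by (rule card_Un_le)
  also have "\<dots> \<le> card (Pow M) + card (Pow M)"
    using assms by (intro add_left_mono card_image_le) auto
  finally show ?thesis using assms by (simp add: card_Pow)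
qed

text \<open>The guard \<open>k \<ge> 2\<close> matters: for \<open>k = 1\<close> no \<open>G\<close>
  completes a copy, and the number of exceptions grows with \<open>n\<close>.\<close>

theorem theorem2p3:
  fixes k :: "nat"
  assumes "k \<ge> 1"
  shows "(\<forall>n\<ge>2 * k. \<not> contains_induced_copy (family_F k n) (two_chains_plus_point k)) \<and>
         (k \<ge> 2 \<longrightarrow>
           (\<exists>c::nat. \<forall>n\<ge>2 * k.
              card {G \<in> Pow {1..n} - family_F k n.
                      \<not> contains_induced_copy (family_F k n \<union> {G}) (two_chains_plus_point k)} \<le> c))"
proof (intro conjI impI allI exI)
  fix n assume n: "n \<ge> 2 * k"
  interpret three_blocks "{1..k}" "{k + 1..2 * k - 1}" "{2 * k..n}" k
    by (rule three_blocks_intervals[OF assms n])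
  show "\<not> contains_induced_copy (family_F k n) (two_chains_plus_point k)"
    unfolding contains_two_chains_plus_point_iff[OF assms] family_F_eq_fam[OF assms n]
    using fam_no_configuration by blast
next
  fix n assume k: "k \<ge> 2" and n: "n \<ge> 2 * k"
  interpret three_blocks "{1..k}" "{k + 1..2 * k - 1}" "{2 * k..n}" k
    by (rule three_blocks_intervals[OF assms n])
  have ground: "ground = {1..n}" unfolding ground_def using assms n by auto
  let ?bad = "{G \<in> Pow {1..n} - family_F k n.
    \<not> contains_induced_copy (family_F k n \<union> {G}) (two_chains_plus_point k)}"
  have "?bad \<subseteq> {G \<in> Pow {1..n}. G \<inter> {2 * k..n} = {} \<or> {2 * k..n} \<subseteq> G}"
  proof
    fix G assume "G \<in> ?bad"
    then have "G \<subseteq> ground" "\<not> (\<exists>C D e. two_chains_and_point k (insert G fam) C D e)"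
      unfolding contains_two_chains_plus_point_iff[OF assms] family_F_eq_fam[OF assms n] ground
      by simp_all
    then show "G \<in> {G \<in> Pow {1..n}. G \<inter> {2 * k..n} = {} \<or> {2 * k..n} \<subseteq> G}"
      using insert_fam_configuration[OF k] unfolding ground by blast
  qed
  then have "card ?bad \<le> card {G \<in> Pow {1..n}. G \<inter> {2 * k..n} = {} \<or> {2 * k..n} \<subseteq> G}"
    by (intro card_mono) auto
  \<comment> \<open>The interval \<open>{1..2 * k}\<close> covers everything outside
    \<open>Z\<close>, overlapping it in the point \<open>2 * k\<close>. Its size depends on
    \<open>k\<close> alone, so the bound serves as \<open>c\<close>.\<close>
  also have "\<dots> \<le> 2 * 2 ^ card {1..2 * k}"
    by (rule card_Pow_avoiding_or_containing) auto
  finally show "card ?bad \<le> 2 * 2 ^ card {1..2 * k}" .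
qed

end
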